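(* Let $(r(n))_{n \geq 0}$ be the $\pm 1$ Golay-Shapiro-Rudin sequence, defined by $r(0) = 1$, $r(2n) = r(n)$ and $r(2n+1) = (-1)^n r(n)$ for all $n \geq 0$ (equivalently, $r(n) = (-1)^{a(n)}$ where $a(n)$ is the number of possibly overlapping occurrences of the block $11$ in the binary expansion of $n$). Let $R$ be a function from the nonnegative integers to the complex numbers such that $|R(n+1) - R(n)| = \mathcal{O}(n^{-2})$. Then $$\sum_{n \geq 1} r(n) \bigl(R(n) - R(2n) + R(2n+1) - 2R(4n+1)\bigr) = R(1).$$
   Formalization: The formal statement additionally assumes R(n) → 0; without it the claim fails (for R constantly 1 the series is −∑ r(n), which diverges), and whenever R(n) tends to a nonzero limit the series diverges, so no meaningful case is lost. *)

theory Defs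
  imports Complex_Main "HOL-Library.Landau_Symbols"
begin

fun golay_shapiro_rudin :: "nat \<Rightarrow> int" where
  "golay_shapiro_rudin n =
     (if n = 0 then 1
      else if even n then golay_shapiro_rudin (n div 2)
      else (- 1) ^ (n div 2) * golay_shapiro_rudin (n div 2))"

declare golay_shapiro_rudin.simps [simp del]

lemma golay_shapiro_rudin_0: "golay_shapiro_rudin 0 = 1"
  by (simp add: golay_shapiro_rudin.simps)

lemma golay_shapiro_rudin_even:
  "golay_shapiro_rudin (2 * n) = golay_shapiro_rudin n"
  by (cases "n = 0") (simp_all add: golay_shapiro_rudin.simps [of "2 * n"])

lemma golay_shapiro_rudin_odd:
  "golay_shapiro_rudin (2 * n + 1) = (- 1) ^ n * golay_shapiro_rudin n"
  by (subst golay_shapiro_rudin.simps) simp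

end

theory Submission
  imports Defs "HOL-Analysis.Summation_Tests" "HOL-Real_Asymp.Real_Asymp"
begin

text \<open>Splitting \<open>\<Sum> r(n) R(n)\<close> by the parity of \<open>n\<close>, and then
  \<open>\<Sum> (-1)\<^sup>n r(n) R(2n+1)\<close> once more, turns the asserted sum over all \<open>n \<ge> 0\<close> into
  a formal cancellation, so its value over \<open>n \<ge> 1\<close> is minus the term at \<open>0\<close>. It remains to see
  that each of the four series converges. With
  \<open>Z(N) = \<Sum>\<^bsub>n<N\<^esub> r(n) (1 + (-1)\<^sup>n \<i>)\<close> the recursion for \<open>r\<close> reads
  \<open>Z(2N) = (1 + \<i>) cnj (Z(N))\<close>, so the partial sums of \<open>r\<close> are \<open>O(\<surd>N)\<close>, and summation by
  parts applies.\<close>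

section \<open>Recursion and modulus of the Golay-Shapiro-Rudin sequence\<close>

abbreviation gsr :: "nat \<Rightarrow> complex" where
  "gsr n \<equiv> of_int (golay_shapiro_rudin n)"

lemma gsr_double: "gsr (2 * n) = gsr n"
  by (simp add: golay_shapiro_rudin_even)

lemma gsr_double_Suc: "gsr (Suc (2 * n)) = (-1) ^ n * gsr n"
  using golay_shapiro_rudin_odd [of n] by simp

lemma norm_gsr: "norm (gsr n) = 1"
proof (induction n rule: less_induct)
  case (less n)
  show ?case
  proof (cases "n = 0")
    case True
    then show ?thesis by (simp add: golay_shapiro_rudin_0)
  next
    case False
    then have IH: "norm (gsr (n div 2)) = 1"
      using less by simp
    show ?thesis
    proof (cases "even n")
      case True
      then show ?thesis
        using IH gsr_double [of "n div 2"] by simp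
    next
      case False
      then have "n = Suc (2 * (n div 2))"
        by presburger
      then show ?thesis
        using IH gsr_double_Suc [of "n div 2"]
        by (metis norm_mult norm_power norm_minus_cancel norm_one power_one mult_1)
    qed
  qed
qed

section \<open>Square-root bound for the partial sums\<close>

lemma sum_lessThan_double:
  fixes f :: "nat \<Rightarrow> 'a::comm_monoid_add"
  shows "(\<Sum>n<2 * N. f n) = (\<Sum>n<N. f (2 * n)) + (\<Sum>n<N. f (Suc (2 * n)))"
  by (induction N) (simp_all add: algebra_simps)

text \<open>The real part is the plain partial sum, the imaginary part the one with signs
  \<open>(-1) ^ n\<close>; doubling \<open>N\<close> mixes these two.\<close>

definition gsr_sum :: "nat \<Rightarrow> complex" where
  "gsr_sum N = (\<Sum>n<N. gsr n * (1 + (-1) ^ n * \<i>))"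

lemma Re_gsr_sum: "Re (gsr_sum N) = Re (\<Sum>n<N. gsr n)"
  unfolding gsr_sum_def Re_sum
proof (rule sum.cong)
  fix n
  show "Re (gsr n * (1 + (-1) ^ n * \<i>)) = Re (gsr n)"
    by (cases "even n") simp_all
qed simp

text \<open>Even indices carry \<open>1 + \<i>\<close>, odd ones
  \<open>1 - \<i> = - \<i> * (1 + \<i>)\<close>; removing the common factor leaves the conjugate
  summands.\<close>

lemma gsr_sum_double: "gsr_sum (2 * N) = (1 + \<i>) * cnj (gsr_sum N)"
proof -
  have "gsr_sum (2 * N) =
      (\<Sum>n<N. gsr n * (1 + \<i>) + (-1) ^ n * gsr n * (1 - \<i>))"
    unfolding gsr_sum_def sum_lessThan_double sum.distrib
    by (simp add: gsr_double gsr_double_Suc[simplified])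
  also have "\<dots> = (1 + \<i>) * cnj (gsr_sum N)"
    unfolding gsr_sum_def cnj_sum sum_distrib_left
    by (rule sum.cong) (simp_all add: algebra_simps)
  finally show ?thesis .
qed

lemma norm_one_plus_ii: "norm (1 + \<i>) = sqrt 2"
  by (simp add: cmod_def)

lemma norm_gsr_sum_double: "norm (gsr_sum (2 * N)) = sqrt 2 * norm (gsr_sum N)"
  by (simp add: gsr_sum_double norm_mult norm_one_plus_ii)

lemma norm_gsr_sum_double_Suc:
  "norm (gsr_sum (Suc (2 * N))) \<le> sqrt 2 * norm (gsr_sum N) + sqrt 2"
proof -
  have "gsr_sum (Suc (2 * N)) = gsr_sum (2 * N) + gsr (2 * N) * (1 + \<i>)"
    by (simp add: gsr_sum_def)
  moreover have "norm (gsr (2 * N) * (1 + \<i>)) = sqrt 2"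
    by (simp only: norm_mult norm_gsr norm_one_plus_ii mult_1)
  ultimately show ?thesis
    using norm_triangle_ineq [of "gsr_sum (2 * N)" "gsr (2 * N) * (1 + \<i>)"] norm_gsr_sum_double
    by simp
qed

text \<open>The subtracted constant absorbs the error \<open>\<surd>2\<close> made at each odd step.\<close>

lemma norm_gsr_sum_le:
  "N > 0 \<Longrightarrow> norm (gsr_sum N) \<le> (2 + 2 * sqrt 2) * sqrt N - (2 + sqrt 2)"
proof (induction N rule: less_induct)
  case (less N)
  \<comment> \<open>\<open>?b\<close> solves \<open>sqrt 2 * x = x + sqrt 2\<close>; then
    \<open>?a\<close> makes the bound an equality at \<open>N = 1\<close>, where
    \<open>?a - ?b = sqrt 2\<close>.\<close>
  let ?a = "2 + 2 * sqrt 2" and ?b = "2 + sqrt 2"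
  define M where "M = N div 2"
  have b: "sqrt 2 * ?b = ?b + sqrt 2"
    by (simp add: algebra_simps)
  consider "N = 1" | "M > 0" "N = 2 * M" | "M > 0" "N = Suc (2 * M)"
    using less.prems that unfolding M_def
    by (metis (mono_tags) div_mult_self1_is_m gr0I mult_0_right even_two_times_div_two
        odd_two_times_div_two_succ Suc_eq_plus1 One_nat_def)
  then show ?case
  proof cases
    case 1
    then show ?thesis
      by (simp add: gsr_sum_def golay_shapiro_rudin_0 cmod_def)
  next
    case 2
    then have "sqrt 2 * norm (gsr_sum M) \<le> sqrt 2 * (?a * sqrt M - ?b)"
      using less.IH [of M] by (intro mult_left_mono) simp_all
    also have "\<dots> = ?a * sqrt N - ?b - sqrt 2"
      using b 2 by (simp add: algebra_simps real_sqrt_mult)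
    finally have "norm (gsr_sum N) \<le> ?a * sqrt N - ?b - sqrt 2"
      using 2 norm_gsr_sum_double by simp
    moreover have "sqrt 2 \<ge> (0::real)"
      by simp
    ultimately show ?thesis
      by linarith
  next
    case 3
    then have "sqrt 2 * norm (gsr_sum M) \<le> sqrt 2 * (?a * sqrt M - ?b)"
      using less.IH [of M] by (intro mult_left_mono) simp_all
    also have "\<dots> = ?a * sqrt (2 * M) - ?b - sqrt 2"
      using b by (simp add: algebra_simps real_sqrt_mult)
    also have "\<dots> \<le> ?a * sqrt N - ?b - sqrt 2"
      using 3 by (intro diff_right_mono mult_left_mono) simp_all
    finally show ?thesis
      using 3 norm_gsr_sum_double_Suc [of M] by simp
  qed
qed

lemma norm_sum_gsr_le: "norm (\<Sum>n<N. gsr n) \<le> (2 + 2 * sqrt 2) * sqrt N"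
proof (cases "N = 0")
  case False
  \<comment> \<open>The partial sum is an integer, so only its real part contributes to the
    norm.\<close>
  have "norm (\<Sum>n<N. gsr n) = \<bar>Re (gsr_sum N)\<bar>"
    by (simp add: Re_gsr_sum flip: of_int_sum)
  also have "\<dots> \<le> norm (gsr_sum N)"
    by (rule abs_Re_le_cmod)
  finally show ?thesis
    using norm_gsr_sum_le [of N] False real_sqrt_ge_zero [of 2] by linarith
qed simp

section \<open>Summation by parts and weighted variation\<close>

lemma sum_by_parts_lessThan:
  fixes f g :: "nat \<Rightarrow> 'a::comm_ring"
  shows "(\<Sum>n<N. f n * g n) =
    (\<Sum>n<N. f n) * g N + (\<Sum>n<N. (\<Sum>k<Suc n. f k) * (g n - g (Suc n)))"
  by (induction N) (simp_all add: algebra_simps)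

text \<open>The weight matches the bound for a partial sum of \<open>Suc n\<close> terms, so
  summability makes the series left by summation by parts converge absolutely.\<close>

definition sqrt_variation :: "(nat \<Rightarrow> complex) \<Rightarrow> nat \<Rightarrow> real" where
  "sqrt_variation Q n = sqrt (Suc n) * norm (Q (Suc n) - Q n)"

lemma sqrt_variation_nonneg: "sqrt_variation Q n \<ge> 0"
  by (simp add: sqrt_variation_def)

text \<open>As \<open>Q\<close> tends to 0, \<open>Q N\<close> telescopes into its later increments;
  there \<open>sqrt N\<close> is below every weight, so the tail of a convergent series
  dominates.\<close>

lemma sqrt_mult_norm_tendsto_0:
  assumes sm: "summable (sqrt_variation Q)" and lim: "Q \<longlonglongrightarrow> 0"
  shows "(\<lambda>N. sqrt N * norm (Q N)) \<longlonglongrightarrow> 0"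
proof (rule tendsto_sandwich)
  show "\<forall>\<^sub>F N in sequentially. 0 \<le> sqrt N * norm (Q N)"
    by simp
  have smN: "summable (\<lambda>k. sqrt_variation Q (k + N))" for N
    using sm by (simp add: summable_iff_shift)
  have "sqrt N * norm (Q N) \<le> (\<Sum>k. sqrt_variation Q (k + N))" for N
  proof -
    have "(\<lambda>k. Q (k + N)) \<longlonglongrightarrow> 0"
      using lim by (rule LIMSEQ_ignore_initial_segment)
    from telescope_sums' [OF this]
    have tel: "(\<lambda>k. sqrt N * (Q (k + N) - Q (Suc k + N))) sums (sqrt N * Q N)"
      using sums_mult by fastforce
    have le: "norm (sqrt N * (Q (k + N) - Q (Suc k + N))) \<le> sqrt_variation Q (k + N)" for k
      unfolding sqrt_variation_def norm_mult
      by (intro mult_mono) (simp_all add: norm_minus_commute)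
    have "norm (\<Sum>k. sqrt N * (Q (k + N) - Q (Suc k + N))) \<le> (\<Sum>k. sqrt_variation Q (k + N))"
      by (rule norm_suminf_le [OF le smN])
    then have "norm (sqrt N * Q N) \<le> (\<Sum>k. sqrt_variation Q (k + N))"
      by (simp only: sums_unique [OF tel])
    then show ?thesis
      by (simp add: norm_mult)
  qed
  then show "\<forall>\<^sub>F N in sequentially. sqrt N * norm (Q N) \<le> (\<Sum>k. sqrt_variation Q (k + N))"
    by simp
  show "(\<lambda>N. \<Sum>k. sqrt_variation Q (k + N)) \<longlonglongrightarrow> 0"
    using tendsto_diff [OF tendsto_const summable_LIMSEQ [OF sm], of "suminf (sqrt_variation Q)"]
    by (simp add: suminf_minus_initial_segment [OF sm])
qed simp

text \<open>In the summation by parts the boundary term vanishes by the preceding lemma, and the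
  rest is dominated by a multiple of \<open>sqrt_variation Q\<close>.\<close>

lemma summable_gsr_mult:
  assumes sm: "summable (sqrt_variation Q)" and lim: "Q \<longlonglongrightarrow> 0"
  shows "summable (\<lambda>n. gsr n * Q n)"
proof -
  let ?a = "2 + 2 * sqrt 2"
  have "(\<lambda>N. (\<Sum>n<N. gsr n) * Q N) \<longlonglongrightarrow> 0"
  proof (rule Lim_null_comparison)
    show "(\<lambda>N. ?a * (sqrt N * norm (Q N))) \<longlonglongrightarrow> 0"
      using tendsto_mult_right_zero [OF sqrt_mult_norm_tendsto_0 [OF assms]] by simp
    have "norm ((\<Sum>n<N. gsr n) * Q N) \<le> ?a * (sqrt N * norm (Q N))" for N
      using mult_right_mono [OF norm_sum_gsr_le [of N], of "norm (Q N)"]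
      by (simp add: norm_mult mult.assoc)
    then show "\<forall>\<^sub>F N in sequentially. norm ((\<Sum>n<N. gsr n) * Q N) \<le> ?a * (sqrt N * norm (Q N))"
      by simp
  qed
  moreover have "summable (\<lambda>n. (\<Sum>k<Suc n. gsr k) * (Q n - Q (Suc n)))"
  proof (rule summable_comparison_test')
    show "summable (\<lambda>n. ?a * sqrt_variation Q n)"
      using sm by (rule summable_mult)
    show "norm ((\<Sum>k<Suc n. gsr k) * (Q n - Q (Suc n))) \<le> ?a * sqrt_variation Q n" for n
      unfolding sqrt_variation_def
      using mult_right_mono [OF norm_sum_gsr_le [of "Suc n"], of "norm (Q (Suc n) - Q n)"]
      by (simp only: norm_mult mult.assoc norm_minus_commute norm_ge_zero)
  qed
  ultimately have "convergent (\<lambda>N. \<Sum>n<N. gsr n * Q n)"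
    unfolding sum_by_parts_lessThan [of gsr Q] summable_iff_convergent
    by (intro convergent_add) (auto simp: convergent_def)
  then show ?thesis
    by (simp add: summable_iff_convergent)
qed

text \<open>Serves \<open>R (2 * n)\<close>, \<open>R (2 * n + 1)\<close> and
  \<open>R (4 * n + 1)\<close>. An increment along the progression is a sum of \<open>m\<close>
  consecutive increments of \<open>Q\<close>, and distinct \<open>n\<close> use disjoint
  blocks.\<close>

lemma summable_sqrt_variation_affine:
  assumes sm: "summable (sqrt_variation Q)" and "m > 0"
  shows "summable (sqrt_variation (\<lambda>n. Q (m * n + b)))"
proof (rule summable_comparison_test')
  let ?w = "\<lambda>n. sqrt_variation Q (n + b)"
  have "summable ?w"
    using sm by (simp add: summable_iff_shift)
  then show "summable (\<lambda>n. sum ?w {n * m..<n * m + m})"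
    by (rule sums_summable [OF sums_group [OF summable_sums \<open>m > 0\<close>]])
  show "norm (sqrt_variation (\<lambda>n. Q (m * n + b)) n) \<le> sum ?w {n * m..<n * m + m}" for n
  proof -
    have "Q (m * Suc n + b) - Q (m * n + b) =
        (\<Sum>k=n * m..<n * m + m. Q (Suc (k + b)) - Q (k + b))"
      using sum_Suc_diff' [of "n * m" "n * m + m" "\<lambda>k. Q (k + b)"]
      by (simp add: algebra_simps)
    then have "sqrt_variation (\<lambda>n. Q (m * n + b)) n \<le>
        (\<Sum>k=n * m..<n * m + m. sqrt (Suc n) * norm (Q (Suc (k + b)) - Q (k + b)))"
      unfolding sqrt_variation_def sum_distrib_left [symmetric]
      by (simp only:) (intro mult_left_mono norm_sum, simp)
    also have "\<dots> \<le> sum ?w {n * m..<n * m + m}"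
      unfolding sqrt_variation_def
    \<comment> \<open>The weight only grows, since \<open>n \<le> n * m \<le> k + b\<close>.\<close>
    proof (intro sum_mono mult_right_mono)
      fix k assume "k \<in> {n * m..<n * m + m}"
      then have "n * m \<le> k"
        by simp
      moreover have "n \<le> n * m"
        using \<open>m > 0\<close> by simp
      ultimately have "n \<le> k + b"
        by linarith
      then show "sqrt (Suc n) \<le> sqrt (Suc (k + b))"
        by simp
    qed simp
    finally show ?thesis
      by (simp add: sqrt_variation_nonneg)
  qed
qed

text \<open>A weight of order \<open>n powr (1/2)\<close> against decay \<open>n powr (-2)\<close>
  leaves the summable exponent \<open>-3/2\<close>.\<close>

lemma summable_sqrt_variation:
  assumes "(\<lambda>n. norm (R (n + 1) - R n)) \<in> O(\<lambda>n. 1 / real n ^ 2)"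
  shows "summable (sqrt_variation R)"
proof -
  have "(\<lambda>n. sqrt (Suc n) * norm (R (n + 1) - R n))
      \<in> O(\<lambda>n. sqrt (Suc n) * (1 / real n ^ 2))"
    using assms by (intro landau_o.big.mult) simp_all
  also have "(\<lambda>n. sqrt (Suc n) * (1 / real n ^ 2)) \<in> O(\<lambda>n. real n powr (-3/2))"
    by real_asymp
  finally have "sqrt_variation R \<in> O(\<lambda>n. real n powr (-3/2))"
    by (simp add: sqrt_variation_def [abs_def])
  moreover have "summable (\<lambda>n. norm (real n powr (-3/2)))"
    by (simp add: summable_real_powr_iff)
  ultimately show ?thesis
    by (rule summable_comparison_test_bigo [rotated])
qed

section \<open>Cancellation among the four series\<close>

theorem theorem14:
  fixes R :: "nat \<Rightarrow> complex"
  assumes "(\<lambda>n. norm (R (n + 1) - R n)) \<in> O(\<lambda>n. 1 / real n ^ 2)"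
    and "R \<longlonglongrightarrow> 0"
  shows "(\<lambda>N. \<Sum>n=1..N. of_int (golay_shapiro_rudin n)
            * (R n - R (2 * n) + R (2 * n + 1) - 2 * R (4 * n + 1)))
         \<longlonglongrightarrow> R 1"
proof -
  let ?P = "\<lambda>m b N. \<Sum>n<N. gsr n * R (m * n + b)"
  define L where "L = (\<lambda>m b. \<Sum>n. gsr n * R (m * n + b))"
  have lim: "?P m b \<longlonglongrightarrow> L m b" if "m > 0" for m b
  proof -
    have "strict_mono (\<lambda>n. m * n + b)"
      using that by (simp add: strict_mono_def)
    from LIMSEQ_subseq_LIMSEQ [OF assms(2) this]
    have "(\<lambda>n. R (m * n + b)) \<longlonglongrightarrow> 0"
      by (simp add: o_def)
    from summable_gsr_mult [OF summable_sqrt_variation_affine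
        [OF summable_sqrt_variation [OF assms(1)] that] this]
    show ?thesis
      unfolding L_def by (rule summable_LIMSEQ)
  qed
  \<comment> \<open>Length \<open>4 * N\<close> makes both parity splittings exact. The sum over the
    indices \<open>4 * n + 3\<close> enters the second and third identities with opposite signs and
    drops out.\<close>
  have split: "?P 1 0 (4 * N) = ?P 2 0 (2 * N) + 2 * ?P 4 1 N - ?P 2 1 (2 * N)" for N
  proof -
    have "?P 1 0 (2 * (2 * N)) = ?P 2 0 (2 * N) +
        (\<Sum>n<2 * N. (-1) ^ n * gsr n * R (Suc (2 * n)))"
      by (subst sum_lessThan_double) (simp add: gsr_double gsr_double_Suc)
    moreover have "(\<Sum>n<2 * N. (-1) ^ n * gsr n * R (Suc (2 * n))) =
        ?P 4 1 N - (\<Sum>n<N. (-1) ^ n * gsr n * R (Suc (Suc (Suc (4 * n)))))"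
      by (subst sum_lessThan_double)
        (simp add: gsr_double gsr_double_Suc sum_negf)
    moreover have "?P 2 1 (2 * N) = ?P 4 1 N + (\<Sum>n<N. (-1) ^ n * gsr n * R (Suc (Suc (Suc (4 * n)))))"
      by (subst sum_lessThan_double) (simp add: gsr_double gsr_double_Suc sum.distrib)
    ultimately show ?thesis
      by simp
  qed
  \<comment> \<open>\<open>split\<close> relates partial sums of different lengths, so limits along
    multiples of \<open>N\<close> are required.\<close>
  have sub: "(\<lambda>N. ?P m b (c * N)) \<longlonglongrightarrow> L m b" if "m > 0" "c > 0" for m b c
    using LIMSEQ_subseq_LIMSEQ [OF lim [OF that(1)], of "\<lambda>N. c * N" b] that(2)
    by (simp add: o_def strict_mono_def)
  have "(\<lambda>N. ?P 1 0 (4 * N)) \<longlonglongrightarrow> L 2 0 + 2 * L 4 1 - L 2 1"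
    unfolding split by (intro tendsto_intros sub lim) simp_all
  then have L: "L 1 0 = L 2 0 + 2 * L 4 1 - L 2 1"
    using sub [of 1 4 0] LIMSEQ_unique by force
  \<comment> \<open>The term at \<open>n = 0\<close> is
    \<open>R 0 - R 0 + R 1 - 2 * R 1 = - R 1\<close>; adding \<open>R 1\<close> removes it, and the
    later shift to \<open>Suc N\<close> makes \<open>N\<close> the last index.\<close>
  have "(\<lambda>N. ?P 1 0 N - ?P 2 0 N + ?P 2 1 N - 2 * ?P 4 1 N + R 1)
      \<longlonglongrightarrow> L 1 0 - L 2 0 + L 2 1 - 2 * L 4 1 + R 1"
    by (intro tendsto_intros lim) simp_all
  then have "(\<lambda>N. ?P 1 0 (Suc N) - ?P 2 0 (Suc N) + ?P 2 1 (Suc N) - 2 * ?P 4 1 (Suc N) + R 1)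
      \<longlonglongrightarrow> R 1"
    by (subst (asm) L, intro LIMSEQ_Suc) simp
  moreover have "?P 1 0 (Suc N) - ?P 2 0 (Suc N) + ?P 2 1 (Suc N) - 2 * ?P 4 1 (Suc N) + R 1 =
      (\<Sum>n=1..N. gsr n * (R n - R (2 * n) + R (2 * n + 1) - 2 * R (4 * n + 1)))" for N
    by (induction N) (simp_all add: golay_shapiro_rudin_0 algebra_simps)
  ultimately show ?thesis
    by simp
qed

end
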